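(* Let $n \ge 1$ be an integer. Let $W_n$ be the total number of bulbs on at the terminal time $n$ in the lightbulb process of size $n$, and let $C_n = C_{m,n}$ have the clubbed binomial distribution, where $m=0$ if $n \bmod 4 \in \{0,3\}$ and $m=1$ if $n \bmod 4 \in \{1,2\}$. Then $$ d_{\mathrm{TV}}(W_n, C_n) \le 2.7314\,\sqrt{n}\, e^{-(n+1)/3}. $$
   Context: Lightbulb process of size $n$: there are $n$ bulbs, all initially off. At each stage $r=1,\ldots,n$, a set of exactly $r$ of the $n$ bulbs is chosen uniformly at random among all subsets of size $r$, independently over different stages, and the status of each chosen bulb is toggled (off to on, or on to off). Formally, let $X_{rk}$, for $r,k \in \{1,\ldots,n\}$, be $\{0,1\}$-valued random variables such that the vectors $(X_{r1},\ldots,X_{rn})$, $r=1,\ldots,n$, are independent and, for $e_1,\ldots,e_n\in\{0,1\}$, $P(X_{r1}=e_1,\ldots,X_{rn}=e_n) = \binom{n}{r}^{-1}$ if $e_1+\cdots+e_n=r$, and $0$ otherwise. Then $I_i = \left(\sum_{r=1}^n X_{ri}\right) \bmod 2 \in \{0,1\}$ is the indicator that bulb $i$ is on at the terminal time, and $W_n=\sum_{i=1}^n I_i$. Clubbed binomial distribution: let $L_{1,n}$ and $L_{0,n}$ denote the sets of all odd and of all even numbers in $\{0,1,\ldots,n\}$, respectively. For $m\in\{0,1\}$, the random variable $C_{m,n}$ has the clubbed binomial distribution if $P(C_{m,n}=i)=\binom{n}{i}\left(\frac12\right)^{n-1}$ for $i\in L_{m,n}$ (and $P(C_{m,n}=i)=0$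 for $i \notin L_{m,n}$). Total variation distance: for random variables $X,Y$ with distributions supported on $\mathbb{Z}$, $d_{\mathrm{TV}}(X,Y)=\sup_{A\subset\mathbb{Z}}|P(X\in A)-P(Y\in A)|$. *)

theory Defs
  imports "HOL-Probability.Probability"
begin

text \<open>
  \<^term>\<open>X r k\<close> indicates whether bulb \<^term>\<open>k\<close> is toggled at stage \<^term>\<open>r\<close>; only the
  indices in \<^term>\<open>{1..n}\<close> matter. Independence is between stages, of the whole vectors
  \<^term>\<open>(\<lambda>k\<in>{1..n}. X r k \<omega>)\<close>, not between the bulbs within a stage.
\<close>

locale lightbulb_process = prob_space M for M :: "'a measure" +
  fixes n :: nat and X :: "nat \<Rightarrow> nat \<Rightarrow> 'a \<Rightarrow> nat"
  assumes toggle_binary: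
    "\<And>r k. r \<in> {1..n} \<Longrightarrow> k \<in> {1..n} \<Longrightarrow> random_variable (count_space {0, 1}) (X r k)"
  and stages_indep:
    "indep_vars (\<lambda>r. PiM {1..n} (\<lambda>k. count_space {0, 1}))
       (\<lambda>r \<omega>. \<lambda>k\<in>{1..n}. X r k \<omega>) {1..n}"
  and stage_distribution:
    "\<And>r e. r \<in> {1..n} \<Longrightarrow> e \<in> {1..n} \<rightarrow>\<^sub>E {0, 1} \<Longrightarrow>
       prob {\<omega> \<in> space M. \<forall>k\<in>{1..n}. X r k \<omega> = e k} =
         (if (\<Sum>k=1..n. e k) = r then 1 / real (n choose r) else 0)"

definition bulb_on :: "nat \<Rightarrow> (nat \<Rightarrow> nat \<Rightarrow> 'a \<Rightarrow> nat) \<Rightarrow> nat \<Rightarrow> 'a \<Rightarrow> nat" where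
  "bulb_on n X i \<omega> = (\<Sum>r=1..n. X r i \<omega>) mod 2"

definition bulbs_on :: "nat \<Rightarrow> (nat \<Rightarrow> nat \<Rightarrow> 'a \<Rightarrow> nat) \<Rightarrow> 'a \<Rightarrow> nat" where
  "bulbs_on n X \<omega> = (\<Sum>i=1..n. bulb_on n X i \<omega>)"

definition clubbed_support :: "nat \<Rightarrow> nat \<Rightarrow> nat set" where
  "clubbed_support m n = {i \<in> {0..n}. if m = 0 then even i else odd i}"

text \<open>The parameter \<^term>\<open>m\<close> is meant to be \<^term>\<open>0::nat\<close> or \<^term>\<open>1::nat\<close>.\<close>

definition clubbed_binomial :: "'b measure \<Rightarrow> nat \<Rightarrow> nat \<Rightarrow> ('b \<Rightarrow> nat) \<Rightarrow> bool" where
  "clubbed_binomial N m n C \<longleftrightarrow>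
     prob_space N \<and> C \<in> measurable N (count_space UNIV) \<and>
     (\<forall>i. measure N {\<omega> \<in> space N. C \<omega> = i} =
        (if i \<in> clubbed_support m n then real (n choose i) * (1 / 2) ^ (n - 1) else 0))"

text \<open>The two variables may live on different probability spaces.\<close>

definition tv_dist :: "'a measure \<Rightarrow> ('a \<Rightarrow> int) \<Rightarrow> 'b measure \<Rightarrow> ('b \<Rightarrow> int) \<Rightarrow> real" where
  "tv_dist M X N Y =
     (SUP A. \<bar>measure M {\<omega> \<in> space M. X \<omega> \<in> A} - measure N {\<omega> \<in> space N. Y \<omega> \<in> A}\<bar>)"

end

theory Submission
  imports Defs
begin

text \<open>
  The law of the set of lit bulbs is a convolution of uniform laws on the levels
  \<open>{R. card R = r}\<close> of the cube of subsets of \<open>V = {1..n}\<close>, so it is diagonalised by the characters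
  \<open>(- 1) ^ card (S \<inter> x)\<close> of the group of subsets under symmetric difference: its Fourier
  coefficient at \<open>S\<close> is the product over all stages \<open>r\<close> of the mean of the character over level
  \<open>r\<close>. The clubbed binomial law is the law of the cardinality of a set that is uniform on one
  parity class, and this uniform law has only two nonzero Fourier coefficients, at \<open>{}\<close> and at
  \<open>V\<close>. There the two laws agree, because the parity of the number of lit bulbs is
  deterministic: it is that of \<open>1 + 2 + \<dots> + n\<close>. Cauchy--Schwarz and Plancherel then
  bound the square of the total variation distance by the sum over the remaining \<open>S\<close> of the
  squared Fourier coefficients of the lightbulb law (\<open>l1_distance_lit_le\<close>).

  To estimate the coefficient at \<open>S\<close>, choose disjoint pairs consisting of one point inside and
  one point outside \<open>S\<close>. Exchanging the points of a pair changes the sign of the character as soon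
  as the stage set separates them, so only sets that separate no pair contribute, and the mean
  of the character at stage \<open>r\<close> is in absolute value at most the probability \<open>p r\<close> that a random \<open>r\<close>-set
  separates no pair. The individual \<open>p r\<close> are awkward, but their average over
  \<open>r = 0, \<dots>, n\<close> is not: a random set whose size is uniform and which is uniform given its
  size is a Polya urn sample, and its restriction to the few points of the pairs is again a
  sample of this kind. So the average is \<open>2 / 3\<close> for one pair and \<open>7 / 15\<close> for two pairs, independently
  of \<open>n\<close>, and by the inequality of the arithmetic and geometric means the product
  of the \<open>p r\<close> is at most the average to the power \<open>n + 1\<close>.

  One pair is available for each \<open>S\<close> other than \<open>{}\<close> and \<open>V\<close>, two pairs unless \<open>S\<close> or its
  complement is a singleton. There are at most \<open>2 * n\<close> sets of the exceptional kind, each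
  with squared coefficient at most \<open>(4 / 9) ^ (n + 1)\<close>, and the other at most \<open>2 ^ n\<close> sets
  contribute at most \<open>2 ^ n * (49 / 225) ^ (n + 1)\<close>, which is smaller than
  \<open>(4 / 9) ^ (n + 1)\<close>. Since \<open>2 / 3 \<le> exp (- 1 / 3)\<close>, the sum is at most
  \<open>3 * n * exp (- 2 * (n + 1) / 3)\<close>, and \<open>sqrt 3 < 2.7314\<close>.
\<close>

section \<open>Fourier analysis on the cube of subsets\<close>

(* The transposition of two points is meant throughout, not the transpose of a matrix. *)
hide_const (open) Finite_Cartesian_Product.transpose

definition parity_char :: "'a set \<Rightarrow> 'a set \<Rightarrow> real" where
  "parity_char S x = (-1) ^ card (S \<inter> x)"

lemma parity_char_commute: "parity_char S x = parity_char x S"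
  by (simp add: parity_char_def Int_commute)

lemma parity_char_empty [simp]: "parity_char {} x = 1" "parity_char x {} = 1"
  by (simp_all add: parity_char_def)

lemma abs_parity_char [simp]: "\<bar>parity_char S x\<bar> = 1"
  by (simp add: parity_char_def power_abs)

lemma parity_char_eq_prod:
  assumes "finite S"
  shows "parity_char S x = (\<Prod>i\<in>S. if i \<in> x then - 1 else 1)"
  using assms by (simp add: parity_char_def prod.If_cases)

text \<open>
  As a function of \<open>S\<close> the product of the two characters is multiplicative, so the sum over all \<open>S\<close>
  factorises over the points of \<open>V\<close>; a point on which \<open>x\<close> and \<open>y\<close> differ gives a zero factor.
\<close>

lemma parity_char_orthogonal:
  assumes "finite V" "x \<subseteq> V" "y \<subseteq> V"
  shows "(\<Sum>S\<in>Pow V. parity_char S x * parity_char S y) = (if x = y then 2 ^ card V else 0)"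
proof -
  define h :: "'a \<Rightarrow> real" where "h i = (if i \<in> x \<longleftrightarrow> i \<in> y then 1 else - 1)" for i
  have "parity_char S x * parity_char S y = prod h S" if "S \<in> Pow V" for S
  proof -
    have "finite S"
      using that assms(1) finite_subset by auto
    then show ?thesis
      by (auto simp: parity_char_eq_prod prod.distrib [symmetric] h_def intro!: prod.cong)
  qed
  then have "(\<Sum>S\<in>Pow V. parity_char S x * parity_char S y) = (\<Sum>S\<in>Pow V. prod h S)"
    by simp
  also have "\<dots> = (\<Prod>i\<in>V. h i + 1)"
    using assms(1) by (simp add: prod_add)
  also have "\<dots> = (if x = y then 2 ^ card V else 0)"
  proof (cases "x = y")
    case True
    then show ?thesis by (simp add: h_def)
  next
    case False
    then obtain i where "i \<in> V" "i \<in> x \<longleftrightarrow> i \<notin> y"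
      using assms(2,3) by blast
    then have "i \<in> V" "h i = - 1"
      by (auto simp: h_def)
    then have "\<exists>i\<in>V. h i + 1 = 0" by (intro bexI [of _ i]) simp_all
    then show ?thesis
      using False assms(1) by simp
  qed
  finally show ?thesis .
qed

lemma parity_char_Plancherel:
  assumes "finite V"
  shows "(\<Sum>S\<in>Pow V. (\<Sum>x\<in>Pow V. parity_char S x * f x)\<^sup>2) = 2 ^ card V * (\<Sum>x\<in>Pow V. (f x)\<^sup>2)"
proof -
  have "(\<Sum>S\<in>Pow V. (\<Sum>x\<in>Pow V. parity_char S x * f x)\<^sup>2)
      = (\<Sum>S\<in>Pow V. \<Sum>x\<in>Pow V. \<Sum>y\<in>Pow V. f x * f y * (parity_char S x * parity_char S y))"
    by (simp add: power2_eq_square sum_product algebra_simps)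
  also have "\<dots> = (\<Sum>x\<in>Pow V. \<Sum>y\<in>Pow V. \<Sum>S\<in>Pow V. f x * f y * (parity_char S x * parity_char S y))"
    by (subst sum.swap, rule sum.cong[OF refl], rule sum.swap)
  also have "\<dots> = (\<Sum>x\<in>Pow V. \<Sum>y\<in>Pow V. f x * f y * (if x = y then 2 ^ card V else 0))"
    unfolding sum_distrib_left [symmetric]
    by (intro sum.cong refl arg_cong2[where f = "(*)"] parity_char_orthogonal) (use assms in auto)
  also have "\<dots> = (\<Sum>x\<in>Pow V. f x * f x * 2 ^ card V)"
    using assms by (simp add: if_distrib [of "(*) _"] sum.delta cong: if_cong)
  finally show ?thesis
    by (simp add: power2_eq_square sum_distrib_left mult.commute)
qed

text \<open>
  The factor \<open>2 ^ card V\<close> lost in Cauchy--Schwarz is exactly the one gained in Plancherel's identity.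
\<close>

lemma l1_norm_le_parity_char_coefficients:
  assumes "finite V"
  shows "(\<Sum>x\<in>Pow V. \<bar>f x\<bar>)\<^sup>2 \<le> (\<Sum>S\<in>Pow V. (\<Sum>x\<in>Pow V. parity_char S x * f x)\<^sup>2)"
proof -
  have "(\<Sum>x\<in>Pow V. \<bar>f x\<bar>)\<^sup>2 \<le> (\<Sum>x\<in>Pow V. \<bar>f x\<bar>\<^sup>2) * card (Pow V)"
    by (rule sum_squared_le_sum_of_squares)
  also have "\<dots> = 2 ^ card V * (\<Sum>x\<in>Pow V. (f x)\<^sup>2)"
    using assms by (simp add: card_Pow)
  finally show ?thesis
    by (simp only: parity_char_Plancherel [OF assms])
qed

definition uniform_parity_class :: "'a set \<Rightarrow> nat \<Rightarrow> 'a set \<Rightarrow> real" where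
  "uniform_parity_class V m x = (if even (card x + m) then 2 / 2 ^ card V else 0)"

text \<open>
  The indicator of a parity class is an affine function of the single character at \<open>V\<close>, which is
  why only two Fourier coefficients survive.
\<close>

lemma parity_char_uniform_parity_class:
  assumes "finite V" "V \<noteq> {}" "S \<subseteq> V"
  shows "(\<Sum>x\<in>Pow V. parity_char S x * uniform_parity_class V m x)
       = (if S = {} then 1 else if S = V then (- 1) ^ m else 0)"
proof -
  have eq: "uniform_parity_class V m x
      = (parity_char x {} + (- 1) ^ m * parity_char x V) / 2 ^ card V" if "x \<in> Pow V" for x
  proof -
    have "parity_char x V = (- 1) ^ card x"
      using that by (simp add: parity_char_def Int_absorb2)
    then show ?thesis
      by (auto simp: uniform_parity_class_def minus_one_power_iff)
  qed
  have "(\<Sum>x\<in>Pow V. parity_char S x * uniform_parity_class V m x)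
      = (\<Sum>x\<in>Pow V. (parity_char x S * parity_char x {} + (- 1) ^ m * (parity_char x S * parity_char x V)) / 2 ^ card V)"
    by (intro sum.cong refl) (simp add: eq parity_char_commute[of S] field_simps)
  also have "\<dots> = ((\<Sum>x\<in>Pow V. parity_char x S * parity_char x {})
      + (- 1) ^ m * (\<Sum>x\<in>Pow V. parity_char x S * parity_char x V)) / 2 ^ card V"
    by (simp only: sum_divide_distrib [symmetric] sum.distrib sum_distrib_left)
  also have "\<dots> = (if S = {} then 1 else if S = V then (- 1) ^ m else 0)"
    using assms by (simp add: parity_char_orthogonal [OF assms(1,3)] del: parity_char_empty)
  finally show ?thesis .
qed

section \<open>Cancellation by exchanging two points\<close>

definition level :: "'a set \<Rightarrow> nat \<Rightarrow> 'a set set" where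
  "level V r = {R \<in> Pow V. card R = r}"

lemma finite_level: "finite V \<Longrightarrow> finite (level V r)"
  by (simp add: level_def)

lemma card_level: "finite V \<Longrightarrow> card (level V r) = card V choose r"
  by (simp add: level_def n_subsets)

text \<open>
  With \<open>s = card S\<close> and \<open>n = card V\<close>, this is the value at \<open>s\<close> of the \<open>r\<close>-th Krawtchouk polynomial,
  normalised to be \<open>1\<close> at \<open>s = 0\<close>.
\<close>

definition level_mean :: "'a set \<Rightarrow> 'a set \<Rightarrow> nat \<Rightarrow> real" where
  "level_mean V S r = (\<Sum>R\<in>level V r. parity_char S R) / (card V choose r)"

lemma parity_char_transpose:
  assumes "finite R" "a \<in> S" "b \<notin> S" "\<not> (a \<in> R \<longleftrightarrow> b \<in> R)"
  shows "parity_char S (transpose a b ` R) = - parity_char S R"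
proof -
  have ab: "a \<noteq> b"
    using assms by auto
  show ?thesis
  proof (cases "a \<in> R")
    case True
    then have "S \<inter> R = insert a (S \<inter> transpose a b ` R)" "a \<notin> transpose a b ` R"
      using assms ab by (auto simp: in_transpose_image_iff Transposition.transpose_def split: if_splits)
    then show ?thesis
      using assms(1) by (simp add: parity_char_def)
  next
    case False
    then have "S \<inter> transpose a b ` R = insert a (S \<inter> R)"
      using assms ab by (auto simp: in_transpose_image_iff Transposition.transpose_def split: if_splits)
    then show ?thesis
      using assms(1) False by (simp add: parity_char_def)
  qed
qed

text \<open>
  Exchanging \<open>a\<close> and \<open>b\<close> is a sign-reversing involution on the sets that separate them. The family
  is arbitrary so that the lemma can be applied again, with a second pair, to the sets that
  survive the first application.
\<close>

lemma sum_parity_char_unsplit: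
  assumes fin: "finite \<R>" "\<And>R. R \<in> \<R> \<Longrightarrow> finite R"
    and ab: "a \<in> S" "b \<notin> S"
    and closed: "\<And>R. R \<in> \<R> \<Longrightarrow> transpose a b ` R \<in> \<R>"
  shows "(\<Sum>R\<in>\<R>. parity_char S R) = (\<Sum>R\<in>{R \<in> \<R>. a \<in> R \<longleftrightarrow> b \<in> R}. parity_char S R)"
proof -
  let ?B = "{R \<in> \<R>. \<not> (a \<in> R \<longleftrightarrow> b \<in> R)}"
  have inv: "transpose a b ` transpose a b ` R = R" for R
    by (simp add: image_comp)
  have mem: "a \<in> transpose a b ` R \<longleftrightarrow> b \<in> R" "b \<in> transpose a b ` R \<longleftrightarrow> a \<in> R" for R
    by (simp_all add: in_transpose_image_iff)
  have "(\<Sum>R\<in>?B. parity_char S R) = (\<Sum>R\<in>?B. - parity_char S R)"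
    by (rule sum.reindex_bij_witness [where i = "(`) (transpose a b)" and j = "(`) (transpose a b)"])
      (use fin ab closed in \<open>auto simp: inv mem parity_char_transpose\<close>)
  then have "(\<Sum>R\<in>?B. parity_char S R) = 0"
    by (simp add: sum_negf)
  moreover have "(\<Sum>R\<in>\<R>. parity_char S R)
      = (\<Sum>R\<in>{R \<in> \<R>. a \<in> R \<longleftrightarrow> b \<in> R}. parity_char S R) + (\<Sum>R\<in>?B. parity_char S R)"
    by (subst sum.union_disjoint [symmetric]) (use fin in \<open>auto intro!: sum.cong\<close>)
  ultimately show ?thesis
    by simp
qed

section \<open>Averaging over the sizes\<close>

text \<open>
  The probability that a Polya urn, started with one ball of each of two colours, produces in
  \<open>N\<close> draws one prescribed colour pattern with \<open>r\<close> draws of the first colour; equivalently, the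
  weight of one set of size \<open>r\<close> among the subsets of \<open>N\<close> points when first the size is chosen
  uniformly in \<open>{0..N}\<close> and then the set.
\<close>

definition urn_weight :: "nat \<Rightarrow> nat \<Rightarrow> real" where
  "urn_weight N r = 1 / (real (N + 1) * real (N choose r))"

text \<open>The next draw of the urn has one of two outcomes.\<close>

lemma urn_weight_split:
  assumes "r \<le> N"
  shows "urn_weight (Suc N) r + urn_weight (Suc N) (Suc r) = urn_weight N r"
proof -
  have c: "real (N choose r) > 0"
    using assms by simp
  have "real (Suc N - r) * real (Suc N choose r) = real (Suc N) * real (N choose r)"
    using binomial_absorb_comp[of "Suc N" r] by (metis diff_Suc_1 of_nat_mult)
  then have 1: "real (Suc N choose r) = real (Suc N) * real (N choose r) / real (Suc N - r)"
    using assms by (simp add: field_simps)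
  have "real (Suc r) * real (Suc N choose Suc r) = real (Suc N) * real (N choose r)"
    using Suc_times_binomial[of r N] by (metis of_nat_mult)
  then have 2: "real (Suc N choose Suc r) = real (Suc N) * real (N choose r) / real (Suc r)"
    by (simp add: field_simps)
  have "real (Suc N - r) = real N + 1 - real r"
    using assms by (simp add: of_nat_diff)
  then show ?thesis
    unfolding urn_weight_def 1 2 using c assms by (simp add: divide_simps)
qed

text \<open>
  Consistency of the urn: adding the points outside \<open>F\<close> one at a time, each new point splits the
  weight of a set between the set without and the set with this point.
\<close>

lemma sum_urn_weight_extensions:
  assumes "finite V" "F \<subseteq> V" "Q \<subseteq> F"
  shows "(\<Sum>R\<in>{R \<in> Pow V. R \<inter> F = Q}. urn_weight (card V) (card R)) = urn_weight (card F) (card Q)"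
proof -
  have fF: "finite F"
    using assms finite_subset by blast
  have "(\<Sum>R\<in>{R \<in> Pow (F \<union> D). R \<inter> F = Q}. urn_weight (card (F \<union> D)) (card R))
      = urn_weight (card F) (card Q)" if "finite D" "D \<inter> F = {}" for D
    using that
  proof (induction D)
    case empty
    have "{R \<in> Pow F. R \<inter> F = Q} = {Q}"
      using assms(3) by auto
    then show ?case by simp
  next
    case (insert v D)
    let ?A = "{R \<in> Pow (F \<union> D). R \<inter> F = Q}"
    have v: "v \<notin> F \<union> D" and fin: "finite (F \<union> D)"
      using insert fF by auto
    have split: "{R \<in> Pow (F \<union> insert v D). R \<inter> F = Q} = ?A \<union> insert v ` ?A"
    proof (intro equalityI subsetI)
      fix R assume R: "R \<in> {R \<in> Pow (F \<union> insert v D). R \<inter> F = Q}"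
      show "R \<in> ?A \<union> insert v ` ?A"
      proof (cases "v \<in> R")
        case True
        then have "R = insert v (R - {v})" "R - {v} \<in> ?A"
          using R v by auto
        then show ?thesis by blast
      next
        case False
        then show ?thesis using R by auto
      qed
    qed (use v in auto)
    have inj: "inj_on (insert v) ?A"
      using v by (auto simp: inj_on_def)
    have "(\<Sum>R\<in>{R \<in> Pow (F \<union> insert v D). R \<inter> F = Q}. urn_weight (card (F \<union> insert v D)) (card R))
        = (\<Sum>R\<in>?A. urn_weight (Suc (card (F \<union> D))) (card R))
          + (\<Sum>R\<in>insert v ` ?A. urn_weight (Suc (card (F \<union> D))) (card R))"
      unfolding split using v fin by (subst sum.union_disjoint) auto
    also have "\<dots> = (\<Sum>R\<in>?A. urn_weight (Suc (card (F \<union> D))) (card R)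
          + urn_weight (Suc (card (F \<union> D))) (Suc (card R)))"
    proof -
      have "card (insert v R) = Suc (card R)" if "R \<in> ?A" for R
        using that v fin finite_subset[of R "F \<union> D"] by (subst card_insert_disjoint) auto
      then have "(\<Sum>R\<in>insert v ` ?A. urn_weight (Suc (card (F \<union> D))) (card R))
          = (\<Sum>R\<in>?A. urn_weight (Suc (card (F \<union> D))) (Suc (card R)))"
        unfolding sum.reindex[OF inj] comp_def by (intro sum.cong) simp_all
      then show ?thesis
        by (simp only: sum.distrib)
    qed
    also have "\<dots> = (\<Sum>R\<in>?A. urn_weight (card (F \<union> D)) (card R))"
      by (intro sum.cong refl urn_weight_split) (use fin in \<open>auto intro!: card_mono\<close>)
    also have "\<dots> = urn_weight (card F) (card Q)"
      using insert by auto
    finally show ?case .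
  qed
  from this[of "V - F"] show ?thesis
    using assms by (simp add: Un_absorb1 Diff_Int_distrib2 Int_commute)
qed

text \<open>
  Averaging the proportion of a level over all \<open>card V + 1\<close> levels is taking the probability under
  the urn law, and an event that depends on the trace on \<open>F\<close> only can be evaluated on \<open>F\<close>.
\<close>

lemma sum_level_frequencies:
  assumes "finite V" "F \<subseteq> V" "\<Q> \<subseteq> Pow F"
  shows "(\<Sum>r\<le>card V. card {R \<in> level V r. R \<inter> F \<in> \<Q>} / (card V choose r))
       = (card V + 1) * (\<Sum>Q\<in>\<Q>. urn_weight (card F) (card Q))"
proof -
  let ?B = "{R \<in> Pow V. R \<inter> F \<in> \<Q>}"
  have fQ: "finite \<Q>"
    using assms finite_subset by (metis finite_Pow_iff)
  have "real (card {R \<in> level V r. R \<inter> F \<in> \<Q>}) / (card V choose r)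
      = (\<Sum>R\<in>{R \<in> ?B. card R = r}. 1 / (card V choose card R))" for r
  proof -
    have "{R \<in> level V r. R \<inter> F \<in> \<Q>} = {R \<in> ?B. card R = r}"
      by (auto simp: level_def)
    then show ?thesis by simp
  qed
  then have "(\<Sum>r\<le>card V. real (card {R \<in> level V r. R \<inter> F \<in> \<Q>}) / (card V choose r))
      = (\<Sum>r\<in>{..card V}. \<Sum>R\<in>{R \<in> ?B. card R = r}. 1 / (card V choose card R))"
    by (simp only:)
  also have "\<dots> = (\<Sum>R\<in>?B. 1 / (card V choose card R))"
    by (rule sum.group) (use assms(1) card_mono in auto)
  also have "\<dots> = (\<Sum>R\<in>?B. (card V + 1) * urn_weight (card V) (card R))"
    by (simp add: urn_weight_def del: of_nat_Suc of_nat_add)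
  also have "\<dots> = (card V + 1) * (\<Sum>Q\<in>\<Q>. \<Sum>R\<in>{R \<in> ?B. R \<inter> F = Q}. urn_weight (card V) (card R))"
    unfolding sum_distrib_left [symmetric]
    by (subst sum.group) (use assms(1) fQ in auto)
  also have "(\<Sum>Q\<in>\<Q>. \<Sum>R\<in>{R \<in> ?B. R \<inter> F = Q}. urn_weight (card V) (card R))
      = (\<Sum>Q\<in>\<Q>. urn_weight (card F) (card Q))"
  proof (rule sum.cong[OF refl])
    fix Q assume "Q \<in> \<Q>"
    then have "{R \<in> ?B. R \<inter> F = Q} = {R \<in> Pow V. R \<inter> F = Q}" "Q \<subseteq> F"
      using assms(3) by auto
    then show "(\<Sum>R\<in>{R \<in> ?B. R \<inter> F = Q}. urn_weight (card V) (card R)) = urn_weight (card F) (card Q)"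
      using sum_urn_weight_extensions[OF assms(1,2)] by simp
  qed
  finally show ?thesis .
qed

text \<open>
  The inequality of the arithmetic and geometric means, from \<open>t \<le> exp (t - 1)\<close> at \<open>t = x i / \<rho>\<close>.
\<close>

lemma prod_le_power_of_mean_bound:
  fixes x :: "'i \<Rightarrow> real" and \<rho> :: real
  assumes "\<And>i. i \<in> I \<Longrightarrow> 0 \<le> x i" and "0 < \<rho>" and "(\<Sum>i\<in>I. x i) \<le> card I * \<rho>"
  shows "(\<Prod>i\<in>I. x i) \<le> \<rho> ^ card I"
proof (cases "finite I")
  case True
  have "(\<Prod>i\<in>I. x i) \<le> (\<Prod>i\<in>I. \<rho> * exp (x i / \<rho> - 1))"
  proof (rule prod_mono)
    fix i assume "i \<in> I"
    have "x i / \<rho> \<le> exp (x i / \<rho> - 1)"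
      using exp_ge_add_one_self[of "x i / \<rho> - 1"] by simp
    then show "0 \<le> x i \<and> x i \<le> \<rho> * exp (x i / \<rho> - 1)"
      using assms \<open>i \<in> I\<close> by (simp add: field_simps)
  qed
  also have "\<dots> = \<rho> ^ card I * exp ((\<Sum>i\<in>I. x i) / \<rho> - card I)"
    using True by (simp add: prod.distrib exp_sum [symmetric] sum_subtractf sum_divide_distrib)
  also have "\<dots> \<le> \<rho> ^ card I * 1"
    using assms by (intro mult_left_mono) (auto simp: field_simps)
  finally show ?thesis by simp
qed simp

text \<open>
  The mean over level \<open>0\<close> is \<open>1\<close>, so this level may be added to the product; this makes the
  number of factors \<open>card V + 1\<close> and matches the range of the average.
\<close>

lemma prod_level_mean_le:
  assumes V: "finite V" "F \<subseteq> V" "\<Q> \<subseteq> Pow F"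
    and cancel: "\<And>r. (\<Sum>R\<in>level V r. parity_char S R) = (\<Sum>R\<in>{R \<in> level V r. R \<inter> F \<in> \<Q>}. parity_char S R)"
    and pos: "0 < (\<Sum>Q\<in>\<Q>. urn_weight (card F) (card Q))"
  shows "(\<Prod>r=1..card V. \<bar>level_mean V S r\<bar>) \<le> (\<Sum>Q\<in>\<Q>. urn_weight (card F) (card Q)) ^ (card V + 1)"
proof -
  have "\<bar>level_mean V S r\<bar> \<le> card {R \<in> level V r. R \<inter> F \<in> \<Q>} / (card V choose r)" for r
  proof -
    have "\<bar>\<Sum>R\<in>{R \<in> level V r. R \<inter> F \<in> \<Q>}. parity_char S R\<bar>
        \<le> (\<Sum>R\<in>{R \<in> level V r. R \<inter> F \<in> \<Q>}. \<bar>parity_char S R\<bar>)"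
      by (rule sum_abs)
    then show ?thesis
      by (simp add: level_mean_def cancel divide_right_mono)
  qed
  then have le: "(\<Sum>r\<le>card V. \<bar>level_mean V S r\<bar>) \<le> (card V + 1) * (\<Sum>Q\<in>\<Q>. urn_weight (card F) (card Q))"
    unfolding sum_level_frequencies[OF V, symmetric] by (intro sum_mono)
  have "level V 0 = {{}}"
    using V(1) finite_subset[OF _ V(1)] by (auto simp: level_def)
  then have "level_mean V S 0 = 1"
    by (simp add: level_mean_def)
  then have "(\<Prod>r=1..card V. \<bar>level_mean V S r\<bar>) = (\<Prod>r\<le>card V. \<bar>level_mean V S r\<bar>)"
    by (simp add: atMost_atLeast0 prod.atLeast_Suc_atMost)
  also have "\<dots> \<le> (\<Sum>Q\<in>\<Q>. urn_weight (card F) (card Q)) ^ card {..card V}"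
    using le pos by (intro prod_le_power_of_mean_bound) auto
  finally show ?thesis by simp
qed

lemma transpose_level:
  assumes "a \<in> V" "b \<in> V" "R \<in> level V r"
  shows "transpose a b ` R \<in> level V r"
proof -
  have "transpose a b ` R \<subseteq> V"
    using assms by (auto simp: level_def Transposition.transpose_def)
  moreover have "card (transpose a b ` R) = card R"
    by (rule card_image) simp
  ultimately show ?thesis
    using assms by (simp add: level_def)
qed

text \<open>
  The two admissible traces on the pair, \<open>{}\<close> and the pair itself, have urn weight \<open>1 / 3\<close> each.
\<close>

lemma prod_level_mean_le_one_pair:
  assumes V: "finite V" "S \<subseteq> V" "a \<in> S" "b \<in> V - S"
  shows "(\<Prod>r=1..card V. \<bar>level_mean V S r\<bar>) \<le> (2 / 3) ^ (card V + 1)"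
proof -
  let ?\<Q> = "{{}, {a, b}}"
  have ab: "a \<noteq> b" using V by auto
  have w: "(\<Sum>Q\<in>?\<Q>. urn_weight (card {a, b}) (card Q)) = 2 / 3"
    using ab by (simp add: urn_weight_def)
  have "(\<Prod>r=1..card V. \<bar>level_mean V S r\<bar>) \<le> (\<Sum>Q\<in>?\<Q>. urn_weight (card {a, b}) (card Q)) ^ (card V + 1)"
  proof (rule prod_level_mean_le)
    fix r
    have fin: "finite (level V r)" "\<And>R. R \<in> level V r \<Longrightarrow> finite R"
      using V(1) by (auto simp: finite_level level_def intro: finite_subset)
    have "(\<Sum>R\<in>level V r. parity_char S R) = (\<Sum>R\<in>{R \<in> level V r. a \<in> R \<longleftrightarrow> b \<in> R}. parity_char S R)"
      by (rule sum_parity_char_unsplit)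
        (use V fin in \<open>auto intro!: transpose_level\<close>)
    also have "{R \<in> level V r. a \<in> R \<longleftrightarrow> b \<in> R} = {R \<in> level V r. R \<inter> {a, b} \<in> ?\<Q>}"
      by auto
    finally show "(\<Sum>R\<in>level V r. parity_char S R) = (\<Sum>R\<in>{R \<in> level V r. R \<inter> {a, b} \<in> ?\<Q>}. parity_char S R)" .
  qed (use V w in auto)
  then show ?thesis unfolding w .
qed

text \<open>
  On four points the urn weights of the admissible traces \<open>{}\<close>, a pair, the other pair and
  everything are \<open>1 / 5\<close>, \<open>1 / 30\<close>, \<open>1 / 30\<close> and \<open>1 / 5\<close>.
\<close>

lemma prod_level_mean_le_two_pairs:
  assumes V: "finite V" "S \<subseteq> V" "{a, c} \<subseteq> S" "a \<noteq> c" "{b, d} \<subseteq> V - S" "b \<noteq> d"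
  shows "(\<Prod>r=1..card V. \<bar>level_mean V S r\<bar>) \<le> (7 / 15) ^ (card V + 1)"
proof -
  let ?\<Q> = "{{}, {a, b}, {c, d}, {a, b, c, d}}" and ?F = "{a, b, c, d}"
  have dist: "a \<noteq> b" "a \<noteq> c" "a \<noteq> d" "b \<noteq> c" "b \<noteq> d" "c \<noteq> d"
    using V by auto
  have ne: "{a, b} \<noteq> {c, d}" "{a, b} \<noteq> ?F" "{c, d} \<noteq> ?F"
    using dist by auto
  have "card ?F = 4" "card {a, b} = 2" "card {c, d} = 2"
    using dist by auto
  moreover have "(4 choose 2) = (6::nat)"
    by (simp add: numeral_eq_Suc)
  ultimately have w: "(\<Sum>Q\<in>?\<Q>. urn_weight (card ?F) (card Q)) = 7 / 15"
    using ne by (simp add: urn_weight_def)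
  have "(\<Prod>r=1..card V. \<bar>level_mean V S r\<bar>) \<le> (\<Sum>Q\<in>?\<Q>. urn_weight (card ?F) (card Q)) ^ (card V + 1)"
  proof (rule prod_level_mean_le)
    fix r
    let ?G = "{R \<in> level V r. a \<in> R \<longleftrightarrow> b \<in> R}"
    have fin: "finite (level V r)" "\<And>R. R \<in> level V r \<Longrightarrow> finite R"
      using V(1) by (auto simp: finite_level level_def intro: finite_subset)
    have "(\<Sum>R\<in>level V r. parity_char S R) = (\<Sum>R\<in>?G. parity_char S R)"
      by (rule sum_parity_char_unsplit) (use V fin in \<open>auto intro!: transpose_level\<close>)
    also have "\<dots> = (\<Sum>R\<in>{R \<in> ?G. c \<in> R \<longleftrightarrow> d \<in> R}. parity_char S R)"
    proof (rule sum_parity_char_unsplit)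
      fix R assume R: "R \<in> ?G"
      have "a \<in> transpose c d ` R \<longleftrightarrow> a \<in> R" "b \<in> transpose c d ` R \<longleftrightarrow> b \<in> R"
        using dist by (simp_all add: in_transpose_image_iff)
      then show "transpose c d ` R \<in> ?G"
        using R V transpose_level[of c V d R r] by auto
    qed (use V fin in auto)
    also have "{R \<in> ?G. c \<in> R \<longleftrightarrow> d \<in> R} = {R \<in> level V r. R \<inter> ?F \<in> ?\<Q>}"
    proof -
      have "(a \<in> R \<longleftrightarrow> b \<in> R) \<and> (c \<in> R \<longleftrightarrow> d \<in> R) \<longleftrightarrow> R \<inter> ?F \<in> ?\<Q>" for R
        using dist by (cases "a \<in> R"; cases "b \<in> R"; cases "c \<in> R"; cases "d \<in> R") auto
      then show ?thesis by auto
    qed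
    finally show "(\<Sum>R\<in>level V r. parity_char S R) = (\<Sum>R\<in>{R \<in> level V r. R \<inter> ?F \<in> ?\<Q>}. parity_char S R)" .
  qed (use V w in auto)
  then show ?thesis unfolding w .
qed

section \<open>Fourier coefficients of the lightbulb law\<close>

lemma (in prob_space) expectation_finite_support:
  fixes g :: "'c \<Rightarrow> real"
  assumes Y: "Y \<in> measurable M (count_space UNIV)"
    and F: "finite F" "AE \<omega> in M. Y \<omega> \<in> F"
  shows "expectation (\<lambda>\<omega>. g (Y \<omega>)) = (\<Sum>v\<in>F. g v * prob {\<omega> \<in> space M. Y \<omega> = v})"
proof -
  have ev: "{\<omega> \<in> space M. Y \<omega> = v} \<in> events" for v
    using Y by measurable
  have "expectation (\<lambda>\<omega>. g (Y \<omega>)) = expectation (\<lambda>\<omega>. \<Sum>v\<in>F. g v * indicator {\<omega> \<in> space M. Y \<omega> = v} \<omega>)"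
  proof (rule integral_cong_AE)
    show "(\<lambda>\<omega>. g (Y \<omega>)) \<in> borel_measurable M"
      by (rule measurable_compose[OF Y]) simp
    show "(\<lambda>\<omega>. \<Sum>v\<in>F. g v * indicator {\<omega> \<in> space M. Y \<omega> = v} \<omega>) \<in> borel_measurable M"
      using ev by measurable
    show "AE \<omega> in M. g (Y \<omega>) = (\<Sum>v\<in>F. g v * indicator {\<omega> \<in> space M. Y \<omega> = v} \<omega>)"
      using F(2) AE_space
    proof eventually_elim
      fix \<omega> assume "Y \<omega> \<in> F" "\<omega> \<in> space M"
      then show "g (Y \<omega>) = (\<Sum>v\<in>F. g v * indicator {\<omega> \<in> space M. Y \<omega> = v} \<omega>)"
        using F(1) by (simp add: indicator_def if_distrib [of "(*) _"] cong: if_cong)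
    qed
  qed
  also have "\<dots> = (\<Sum>v\<in>F. g v * prob {\<omega> \<in> space M. Y \<omega> = v})"
    using ev by (subst Bochner_Integration.integral_sum) (auto simp: integrable_real_indicator emeasure_eq_measure)
  finally show ?thesis .
qed

lemma (in prob_space) prob_finite_support:
  assumes Y: "Y \<in> measurable M (count_space UNIV)"
    and F: "finite F" "AE \<omega> in M. Y \<omega> \<in> F"
  shows "prob {\<omega> \<in> space M. P (Y \<omega>)} = (\<Sum>v\<in>{v \<in> F. P v}. prob {\<omega> \<in> space M. Y \<omega> = v})"
proof -
  have ev: "{\<omega> \<in> space M. P (Y \<omega>)} \<in> events"
    using measurable_sets[OF Y, of "Collect P"] by (simp add: vimage_def Int_def conj_commute)
  have "prob {\<omega> \<in> space M. P (Y \<omega>)} = expectation (\<lambda>\<omega>. of_bool (P (Y \<omega>)))"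
    using ev by (subst Bochner_Integration.integral_cong[OF refl, of _ _ "indicator {\<omega> \<in> space M. P (Y \<omega>)}"]) (auto simp: indicator_def)
  also have "\<dots> = (\<Sum>v\<in>F. of_bool (P v) * prob {\<omega> \<in> space M. Y \<omega> = v})"
    by (rule expectation_finite_support) (use assms in auto)
  also have "\<dots> = (\<Sum>v\<in>{v \<in> F. P v}. prob {\<omega> \<in> space M. Y \<omega> = v})"
    using F(1) by (simp add: sum.inter_filter of_bool_def if_distrib [of "\<lambda>c. c * _"] cong: if_cong)
  finally show ?thesis .
qed

definition toggled :: "nat \<Rightarrow> (nat \<Rightarrow> nat \<Rightarrow> 'a \<Rightarrow> nat) \<Rightarrow> nat \<Rightarrow> 'a \<Rightarrow> nat set" where
  "toggled n X r \<omega> = {k \<in> {1..n}. X r k \<omega> = 1}"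

definition lit :: "nat \<Rightarrow> (nat \<Rightarrow> nat \<Rightarrow> 'a \<Rightarrow> nat) \<Rightarrow> 'a \<Rightarrow> nat set" where
  "lit n X \<omega> = {i \<in> {1..n}. bulb_on n X i \<omega> = 1}"

lemma card_lit: "card (lit n X \<omega>) = bulbs_on n X \<omega>"
proof -
  have "bulb_on n X i \<omega> = of_bool (bulb_on n X i \<omega> = 1)" for i
    by (auto simp: bulb_on_def)
  then have "bulbs_on n X \<omega> = (\<Sum>i\<in>{1..n}. of_bool (bulb_on n X i \<omega> = 1))"
    unfolding bulbs_on_def by (rule sum.cong[OF refl])
  then show ?thesis
    by (simp add: lit_def Int_def)
qed

context lightbulb_process
begin

lemma toggle_values:
  assumes "r \<in> {1..n}" "k \<in> {1..n}" "\<omega> \<in> space M"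
  shows "X r k \<omega> = 0 \<or> X r k \<omega> = 1"
  using measurable_space[OF toggle_binary[OF assms(1,2)] assms(3)] by auto

lemma toggle_measurable:
  assumes "r \<in> {1..n}" "k \<in> {1..n}"
  shows "X r k \<in> measurable M (count_space UNIV)"
  using measurable_compose[OF toggle_binary[OF assms], of id "count_space UNIV"] by simp

lemma lit_measurable: "lit n X \<in> measurable M (count_space UNIV)"
proof -
  have bulb: "(\<lambda>\<omega>. bulb_on n X i \<omega>) \<in> measurable M (count_space UNIV)" if "i \<in> {1..n}" for i
    unfolding bulb_on_def using toggle_measurable that by measurable
  have "{\<omega> \<in> space M. lit n X \<omega> = x} \<in> events" if "x \<in> Pow {1..n}" for x
  proof -
    have "{\<omega> \<in> space M. lit n X \<omega> = x} = {\<omega> \<in> space M. \<forall>i\<in>{1..n}. (bulb_on n X i \<omega> = 1) = (i \<in> x)}"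
      using that by (auto simp: lit_def)
    also have "\<dots> \<in> events"
      using bulb by measurable
    finally show ?thesis .
  qed
  then have "lit n X \<in> measurable M (count_space (Pow {1..n}))"
    by (auto simp: measurable_count_space_eq2 vimage_def Int_def conj_commute lit_def)
  from measurable_compose[OF this, of id "count_space UNIV"] show ?thesis
    by simp
qed

lemma stage_function_measurable:
  "g \<in> measurable (PiM {1..n} (\<lambda>k. count_space {0, 1 :: nat})) (count_space UNIV)"
  for g :: "(nat \<Rightarrow> nat) \<Rightarrow> 'c"
  by (simp add: count_space_PiM_finite)

lemma toggled_eq_stage: "toggled n X r \<omega> = {k \<in> {1..n}. (\<lambda>k\<in>{1..n}. X r k \<omega>) k = 1}"
  by (auto simp: toggled_def)

lemma toggled_indep: "indep_vars (\<lambda>r. count_space UNIV) (toggled n X) {1..n}"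
  using indep_vars_compose2[OF stages_indep stage_function_measurable, of "\<lambda>r e. {k \<in> {1..n}. e k = 1}"]
  by (simp add: toggled_eq_stage [abs_def])

lemma toggled_measurable:
  assumes "r \<in> {1..n}"
  shows "toggled n X r \<in> measurable M (count_space UNIV)"
  using toggled_indep assms by (simp add: indep_vars_def)

lemma prob_toggled:
  assumes r: "r \<in> {1..n}" and Q: "Q \<subseteq> {1..n}"
  shows "prob {\<omega> \<in> space M. toggled n X r \<omega> = Q} = (if card Q = r then 1 / real (n choose r) else 0)"
proof -
  define e :: "nat \<Rightarrow> nat" where "e = (\<lambda>k\<in>{1..n}. of_bool (k \<in> Q))"
  have e: "e \<in> {1..n} \<rightarrow>\<^sub>E {0, 1}"
    by (auto simp: e_def)
  have "(\<Sum>k=1..n. e k) = card Q"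
    using Q by (simp add: e_def Int_absorb1)
  moreover have "{\<omega> \<in> space M. toggled n X r \<omega> = Q} = {\<omega> \<in> space M. \<forall>k\<in>{1..n}. X r k \<omega> = e k}"
  proof (intro Collect_cong conj_cong refl)
    fix \<omega> assume \<omega>: "\<omega> \<in> space M"
    have "X r k \<omega> = e k \<longleftrightarrow> (k \<in> toggled n X r \<omega> \<longleftrightarrow> k \<in> Q)" if "k \<in> {1..n}" for k
      using toggle_values[OF r that \<omega>] that by (auto simp: toggled_def e_def)
    moreover have "toggled n X r \<omega> \<subseteq> {1..n}"
      by (auto simp: toggled_def)
    ultimately show "toggled n X r \<omega> = Q \<longleftrightarrow> (\<forall>k\<in>{1..n}. X r k \<omega> = e k)"
      using Q by blast
  qed
  ultimately show ?thesis
    using stage_distribution[OF r e] by simp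
qed

lemma expectation_parity_char_toggled:
  assumes r: "r \<in> {1..n}"
  shows "expectation (\<lambda>\<omega>. parity_char S (toggled n X r \<omega>)) = level_mean {1..n} S r"
proof -
  have "expectation (\<lambda>\<omega>. parity_char S (toggled n X r \<omega>))
      = (\<Sum>Q\<in>Pow {1..n}. parity_char S Q * prob {\<omega> \<in> space M. toggled n X r \<omega> = Q})"
    by (rule expectation_finite_support[OF toggled_measurable[OF r]]) (auto simp: toggled_def)
  also have "\<dots> = (\<Sum>Q\<in>Pow {1..n}. if card Q = r then parity_char S Q / real (n choose r) else 0)"
    by (intro sum.cong refl) (simp add: prob_toggled[OF r])
  also have "\<dots> = level_mean {1..n} S r"
    unfolding level_mean_def level_def sum_divide_distrib card_atLeastAtMost diff_Suc_1
    by (subst sum.inter_filter) simp_all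
  finally show ?thesis .
qed

text \<open>
  The lit set is the symmetric difference of the toggled sets, and characters are multiplicative
  for symmetric differences.
\<close>

lemma parity_char_lit:
  assumes S: "S \<subseteq> {1..n}" and \<omega>: "\<omega> \<in> space M"
  shows "parity_char S (lit n X \<omega>) = (\<Prod>r=1..n. parity_char S (toggled n X r \<omega>))"
proof -
  have fin: "finite S"
    using S finite_subset by blast
  have "parity_char S (lit n X \<omega>) = (\<Prod>i\<in>S. (-1) ^ (\<Sum>r=1..n. X r i \<omega>))"
    unfolding parity_char_eq_prod[OF fin]
    by (intro prod.cong refl) (use S in \<open>auto simp: lit_def bulb_on_def minus_one_power_iff odd_iff_mod_2_eq_one\<close>)
  also have "\<dots> = (\<Prod>r=1..n. \<Prod>i\<in>S. (-1) ^ X r i \<omega>)"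
    by (simp add: power_sum) (rule prod.swap)
  also have "\<dots> = (\<Prod>r=1..n. parity_char S (toggled n X r \<omega>))"
    unfolding parity_char_eq_prod[OF fin]
  proof (intro prod.cong refl)
    fix r i assume "r \<in> {1..n}" "i \<in> S"
    then show "(-1) ^ X r i \<omega> = (if i \<in> toggled n X r \<omega> then -1 else 1 :: real)"
      using toggle_values[of r i, OF _ _ \<omega>] S by (auto simp: toggled_def)
  qed
  finally show ?thesis .
qed

lemma parity_char_lit_coefficient:
  assumes "S \<subseteq> {1..n}"
  shows "(\<Sum>x\<in>Pow {1..n}. parity_char S x * prob {\<omega> \<in> space M. lit n X \<omega> = x})
       = (\<Prod>r=1..n. level_mean {1..n} S r)"
proof -
  have "(\<Sum>x\<in>Pow {1..n}. parity_char S x * prob {\<omega> \<in> space M. lit n X \<omega> = x})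
      = expectation (\<lambda>\<omega>. parity_char S (lit n X \<omega>))"
    by (rule expectation_finite_support[OF lit_measurable, symmetric]) (auto simp: lit_def)
  also have "\<dots> = expectation (\<lambda>\<omega>. \<Prod>r=1..n. parity_char S (toggled n X r \<omega>))"
    by (rule Bochner_Integration.integral_cong) (simp_all add: parity_char_lit[OF assms])
  also have "\<dots> = (\<Prod>r=1..n. expectation (\<lambda>\<omega>. parity_char S (toggled n X r \<omega>)))"
  proof (rule indep_vars_lebesgue_integral)
    show "indep_vars (\<lambda>_. borel) (\<lambda>r \<omega>. parity_char S (toggled n X r \<omega>)) {1..n}"
      by (rule indep_vars_compose2[OF toggled_indep]) simp
    fix r assume "r \<in> {1..n}"
    then have "(\<lambda>\<omega>. parity_char S (toggled n X r \<omega>)) \<in> borel_measurable M"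
      using measurable_compose[OF toggled_measurable, of r "parity_char S" borel] by simp
    then show "integrable M (\<lambda>\<omega>. parity_char S (toggled n X r \<omega>))"
      by (intro integrable_const_bound[of _ 1]) auto
  qed simp
  also have "\<dots> = (\<Prod>r=1..n. level_mean {1..n} S r)"
    by (intro prod.cong refl expectation_parity_char_toggled)
  finally show ?thesis .
qed

end

section \<open>The two exceptional coefficients and the sum of the others\<close>

lemma prod_level_mean_empty:
  assumes "finite V"
  shows "(\<Prod>r=1..card V. level_mean V {} r) = 1"
proof (rule prod.neutral, rule ballI)
  fix r assume "r \<in> {1..card V}"
  then show "level_mean V {} r = 1"
    using assms by (simp add: level_mean_def card_level)
qed

lemma even_gauss_sum_iff: "even (\<Sum>r=1..n. r) \<longleftrightarrow> n mod 4 \<in> {0, 3 :: nat}"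
proof (induction n)
  case (Suc n)
  have "(n mod 4 \<in> {0, 3} \<longleftrightarrow> even (Suc n)) \<longleftrightarrow> Suc n mod 4 \<in> {0, 3}"
    by (simp, presburger)
  then show ?case
    using Suc by simp
qed simp

text \<open>
  The character at \<open>V\<close> is constant on each level. The resulting sign is the parity of
  \<open>1 + \<dots> + n\<close>, and this is where the residue of \<open>n\<close> modulo \<open>4\<close> enters.
\<close>

lemma prod_level_mean_full:
  assumes "finite V"
  shows "(\<Prod>r=1..card V. level_mean V V r) = (- 1) ^ (if card V mod 4 \<in> {0, 3} then 0 else 1)"
proof -
  have "level_mean V V r = (- 1) ^ r" if "r \<in> {1..card V}" for r
  proof -
    have "parity_char V R = (- 1) ^ r" if "R \<in> level V r" for R
      using that by (auto simp: parity_char_def level_def Int_absorb1)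
    then show ?thesis
      using that assms by (simp add: level_mean_def card_level)
  qed
  then have "(\<Prod>r=1..card V. level_mean V V r) = (- 1) ^ (\<Sum>r=1..card V. r)"
    by (simp add: power_sum)
  then show ?thesis
    using even_gauss_sum_iff[of "card V"] by (simp add: minus_one_power_iff)
qed

text \<open>
  The sets \<open>S\<close> of size \<open>1\<close> or \<open>n - 1\<close> have only one pair but are few; for all others two pairs
  give a base \<open>49 / 225\<close> that is small enough to absorb the number of sets, as
  \<open>2 * 49 / 225 < 4 / 9\<close>.
\<close>

lemma sum_squared_level_products_le:
  assumes V: "finite V" "V \<noteq> {}"
  shows "(\<Sum>S\<in>Pow V - {{}, V}. (\<Prod>r=1..card V. level_mean V S r)\<^sup>2) \<le> 3 * card V * exp (- 2 * (card V + 1) / 3)"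
proof -
  let ?n = "card V"
  define E where "E = level V 1 \<union> level V (?n - 1)"
  have n1: "?n \<ge> 1"
    using V by (simp add: Suc_le_eq card_gt_0_iff)
  have sq: "(\<Prod>r=1..?n. level_mean V S r)\<^sup>2 \<le> b ^ (?n + 1)"
    if "(\<Prod>r=1..?n. \<bar>level_mean V S r\<bar>) \<le> c ^ (?n + 1)" "c\<^sup>2 = b" for S c b
  proof -
    have "\<bar>\<Prod>r=1..?n. level_mean V S r\<bar> \<le> c ^ (?n + 1)"
      using that(1) by (simp only: abs_prod)
    then have "\<bar>\<Prod>r=1..?n. level_mean V S r\<bar>\<^sup>2 \<le> (c ^ (?n + 1))\<^sup>2"
      by (rule power_mono) simp
    then show ?thesis
      using that(2) by (metis power2_abs power_commutes power_mult power_mult mult.commute)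
  qed
  have one: "(\<Prod>r=1..?n. level_mean V S r)\<^sup>2 \<le> (4 / 9) ^ (?n + 1)" if S: "S \<in> Pow V - {{}, V}" for S
  proof -
    obtain a b where "a \<in> S" "b \<in> V - S"
      using S by blast
    then show ?thesis
      using prod_level_mean_le_one_pair[of V S a b] S V by (intro sq[of _ "2 / 3"]) (auto simp: power2_eq_square)
  qed
  have two: "(\<Prod>r=1..?n. level_mean V S r)\<^sup>2 \<le> (49 / 225) ^ (?n + 1)" if S: "S \<in> Pow V - {{}, V} - E" for S
  proof -
    have fS: "finite S" "finite (V - S)" "S \<subseteq> V"
      using S V finite_subset by auto
    have "card S \<noteq> 0" "card (V - S) \<noteq> 0"
      using S fS by auto
    moreover have "card S \<noteq> 1"
      using S by (auto simp: E_def level_def)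
    moreover have "card (V - S) = ?n - card S" "card S \<le> ?n"
      using fS V by (auto simp: card_Diff_subset card_mono)
    moreover have "card S \<noteq> ?n - 1"
      using S by (auto simp: E_def level_def)
    ultimately have "2 \<le> card S" "2 \<le> card (V - S)"
      by linarith+
    then obtain P Q where "P \<subseteq> S" "card P = 2" "Q \<subseteq> V - S" "card Q = 2"
      using obtain_subset_with_card_n by metis
    then obtain a c b d where "{a, c} \<subseteq> S" "a \<noteq> c" "{b, d} \<subseteq> V - S" "b \<noteq> d"
      unfolding card_2_iff by blast
    then show ?thesis
      using prod_level_mean_le_two_pairs[of V S a c b d] fS V by (intro sq[of _ "7 / 15"]) (auto simp: power2_eq_square)
  qed
  have "card E \<le> card (level V 1) + card (level V (?n - 1))"
    unfolding E_def by (rule card_Un_le)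
  also have "\<dots> = 2 * ?n"
    using V(1) n1 binomial_symmetric[of 1 ?n] by (simp add: card_level)
  finally have cardE: "card E \<le> 2 * ?n" .
  have "(\<Sum>S\<in>Pow V - {{}, V}. (\<Prod>r=1..?n. level_mean V S r)\<^sup>2)
      = (\<Sum>S\<in>(Pow V - {{}, V}) \<inter> E. (\<Prod>r=1..?n. level_mean V S r)\<^sup>2)
        + (\<Sum>S\<in>Pow V - {{}, V} - E. (\<Prod>r=1..?n. level_mean V S r)\<^sup>2)"
    using V(1) by (intro sum.Int_Diff) auto
  also have "(\<Sum>S\<in>(Pow V - {{}, V}) \<inter> E. (\<Prod>r=1..?n. level_mean V S r)\<^sup>2)
      \<le> real (card ((Pow V - {{}, V}) \<inter> E)) * (4 / 9) ^ (?n + 1)"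
    by (rule sum_bounded_above) (use one in auto)
  also have "\<dots> \<le> real (2 * ?n) * (4 / 9) ^ (?n + 1)"
  proof (intro mult_right_mono of_nat_mono)
    have "card ((Pow V - {{}, V}) \<inter> E) \<le> card E"
      using V(1) by (intro card_mono) (auto simp: E_def finite_level)
    then show "card ((Pow V - {{}, V}) \<inter> E) \<le> 2 * ?n"
      using cardE by linarith
  qed simp
  also have "(\<Sum>S\<in>Pow V - {{}, V} - E. (\<Prod>r=1..?n. level_mean V S r)\<^sup>2)
      \<le> real (card (Pow V - {{}, V} - E)) * (49 / 225) ^ (?n + 1)"
    by (rule sum_bounded_above) (use two in auto)
  also have "\<dots> \<le> 2 ^ (?n + 1) * (49 / 225) ^ (?n + 1)"
  proof (intro mult_right_mono)
    have "card (Pow V - {{}, V} - E) \<le> card (Pow V)"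
      using V(1) by (intro card_mono) auto
    then have "real (card (Pow V - {{}, V} - E)) \<le> 2 ^ ?n"
      using V(1) by (simp add: card_Pow)
    then show "real (card (Pow V - {{}, V} - E)) \<le> 2 ^ (?n + 1)"
      by (rule order_trans) simp
  qed simp
  also have "(2 :: real) ^ (?n + 1) * (49 / 225) ^ (?n + 1) \<le> (4 / 9) ^ (?n + 1)"
    unfolding power_mult_distrib [symmetric] by (rule power_mono) auto
  finally have "(\<Sum>S\<in>Pow V - {{}, V}. (\<Prod>r=1..?n. level_mean V S r)\<^sup>2) \<le> (2 * ?n + 1) * (4 / 9) ^ (?n + 1)"
    by (simp add: algebra_simps)
  also have "\<dots> \<le> (3 * ?n) * exp (- 2 * (?n + 1) / 3)"
  proof (rule mult_mono)
    have "2 / 3 \<le> exp (- 1 / 3 :: real)"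
      using exp_ge_add_one_self[of "- 1 / 3 :: real"] by simp
    then have "(2 / 3) ^ (2 * (?n + 1)) \<le> exp (- 1 / 3 :: real) ^ (2 * (?n + 1))"
      by (rule power_mono) simp
    also have "\<dots> = exp (- 2 * (?n + 1) / 3)"
      unfolding exp_of_nat_mult [symmetric] by (simp add: field_simps)
    finally show "(4 / 9 :: real) ^ (?n + 1) \<le> exp (- 2 * (?n + 1) / 3)"
      by (simp only: power_mult) (simp add: power2_eq_square)
  qed (use n1 in auto)
  finally show ?thesis by simp
qed

section \<open>Comparison with the clubbed binomial law\<close>

lemma (in lightbulb_process) l1_distance_lit_le:
  assumes n: "n \<ge> 1" and m: "m = (if n mod 4 \<in> {0, 3} then 0 else 1)"
  shows "(\<Sum>x\<in>Pow {1..n}. \<bar>prob {\<omega> \<in> space M. lit n X \<omega> = x} - uniform_parity_class {1..n} m x\<bar>)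
         \<le> sqrt (3 * n * exp (- 2 * (n + 1) / 3))"
proof (rule real_le_rsqrt)
  let ?V = "{1..n}" and ?c = "\<lambda>S. (\<Prod>r=1..n. level_mean {1..n} S r)"
  let ?f = "\<lambda>x. prob {\<omega> \<in> space M. lit n X \<omega> = x} - uniform_parity_class {1..n} m x"
  have V: "finite ?V" "?V \<noteq> {}" "card ?V = n"
    using n by auto
  have coeff: "(\<Sum>x\<in>Pow ?V. parity_char S x * ?f x)
      = ?c S - (if S = {} then 1 else if S = ?V then (- 1) ^ m else 0)" if "S \<in> Pow ?V" for S
    using that parity_char_lit_coefficient[of S] parity_char_uniform_parity_class[OF V(1,2), of S m]
    by (simp add: right_diff_distrib sum_subtractf)
  have "(\<Sum>x\<in>Pow ?V. \<bar>?f x\<bar>)\<^sup>2 \<le> (\<Sum>S\<in>Pow ?V. (\<Sum>x\<in>Pow ?V. parity_char S x * ?f x)\<^sup>2)"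
    by (rule l1_norm_le_parity_char_coefficients) simp
  also have "\<dots> = (\<Sum>S\<in>Pow ?V - {{}, ?V}. (\<Sum>x\<in>Pow ?V. parity_char S x * ?f x)\<^sup>2)"
  proof (rule sum.mono_neutral_right)
    have "?c {} = 1" "?c ?V = (- 1) ^ m"
      using prod_level_mean_empty[OF V(1)] prod_level_mean_full[OF V(1)] V(3) m by auto
    then show "\<forall>S\<in>Pow ?V - (Pow ?V - {{}, ?V}). (\<Sum>x\<in>Pow ?V. parity_char S x * ?f x)\<^sup>2 = 0"
      using V(2) coeff by auto
  qed auto
  also have "\<dots> = (\<Sum>S\<in>Pow ?V - {{}, ?V}. (?c S)\<^sup>2)"
    by (intro sum.cong refl arg_cong[where f = "\<lambda>t. t\<^sup>2"], subst coeff) auto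
  also have "\<dots> \<le> 3 * n * exp (- 2 * (n + 1) / 3)"
    using sum_squared_level_products_le[OF V(1,2)] V(3) by simp
  finally show "(\<Sum>x\<in>Pow ?V. \<bar>?f x\<bar>)\<^sup>2 \<le> 3 * n * exp (- 2 * (n + 1) / 3)" .
qed

text \<open>
  The clubbed binomial law is the law of the cardinality of a uniform set of the given parity, so
  comparing it with the number of lit bulbs reduces to comparing two laws on sets.
\<close>

lemma clubbed_binomial_prob:
  assumes C: "clubbed_binomial N m n C" and m: "m \<in> {0, 1}" and n: "n \<ge> 1"
  shows "measure N {\<omega> \<in> space N. P (C \<omega>)} = (\<Sum>x\<in>{x \<in> Pow {1..n}. P (card x)}. uniform_parity_class {1..n} m x)"
proof -
  interpret N: prob_space N
    using C by (simp add: clubbed_binomial_def)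
  have meas: "C \<in> measurable N (count_space UNIV)"
    and mass: "\<And>i. N.prob {\<omega> \<in> space N. C \<omega> = i}
      = (if i \<in> clubbed_support m n then real (n choose i) * (1 / 2) ^ (n - 1) else 0)"
    using C by (auto simp: clubbed_binomial_def)
  (* The values above n have probability zero one by one, hence jointly. *)
  have "AE \<omega> in N. C \<omega> \<noteq> i" if "i > n" for i
  proof -
    have "N.prob {\<omega> \<in> space N. C \<omega> = i} = 0"
      using that by (simp add: mass clubbed_support_def)
    moreover have "{\<omega> \<in> space N. C \<omega> = i} \<in> N.events"
      using meas by measurable
    ultimately show ?thesis
      by (subst (asm) N.prob_eq_0) (auto elim: eventually_mono)
  qed
  then have "AE \<omega> in N. \<forall>i. i > n \<longrightarrow> C \<omega> \<noteq> i"
    unfolding AE_all_countable by auto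
  then have AE: "AE \<omega> in N. C \<omega> \<in> {..n}"
    by eventually_elim (auto simp: not_less [symmetric])
  have half: "(2 :: real) / 2 ^ n = (1 / 2) ^ (n - 1)"
    using n by (cases n) (auto simp: power_divide)
  have "measure N {\<omega> \<in> space N. P (C \<omega>)} = (\<Sum>i\<in>{i \<in> {..n}. P i}. N.prob {\<omega> \<in> space N. C \<omega> = i})"
    using meas AE by (intro N.prob_finite_support) auto
  also have "\<dots> = (\<Sum>i\<in>{i \<in> {..n}. P i}. \<Sum>x\<in>{x \<in> {x \<in> Pow {1..n}. P (card x)}. card x = i}. uniform_parity_class {1..n} m x)"
  proof (rule sum.cong[OF refl])
    fix i assume i: "i \<in> {i \<in> {..n}. P i}"
    then have "{x \<in> {x \<in> Pow {1..n}. P (card x)}. card x = i} = level {1..n} i"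
      by (auto simp: level_def)
    moreover have "(\<Sum>x\<in>level {1..n} i. uniform_parity_class {1..n} m x)
        = (\<Sum>x\<in>level {1..n} i. if even (i + m) then (1 / 2) ^ (n - 1) else 0)"
      by (intro sum.cong refl) (simp add: uniform_parity_class_def level_def half)
    ultimately show "N.prob {\<omega> \<in> space N. C \<omega> = i}
        = (\<Sum>x\<in>{x \<in> {x \<in> Pow {1..n}. P (card x)}. card x = i}. uniform_parity_class {1..n} m x)"
      using i m by (auto simp: mass clubbed_support_def card_level)
  qed
  also have "\<dots> = (\<Sum>x\<in>{x \<in> Pow {1..n}. P (card x)}. uniform_parity_class {1..n} m x)"
  proof (rule sum.group)
    show "card ` {x \<in> Pow {1..n}. P (card x)} \<subseteq> {i \<in> {..n}. P i}"
      using card_mono[of "{1..n}"] by auto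
  qed auto
  finally show ?thesis .
qed

theorem theorem1p1:
  fixes M :: "'a measure" and N :: "'b measure"
    and n :: nat and X :: "nat \<Rightarrow> nat \<Rightarrow> 'a \<Rightarrow> nat" and C :: "'b \<Rightarrow> nat"
  assumes "n \<ge> 1"
    and "lightbulb_process M n X"
    and "clubbed_binomial N (if n mod 4 \<in> {0, 3} then 0 else 1) n C"
  shows "tv_dist M (\<lambda>\<omega>. int (bulbs_on n X \<omega>)) N (\<lambda>\<omega>. int (C \<omega>))
           \<le> 2.7314 * sqrt (real n) * exp (- (real n + 1) / 3)"
proof -
  interpret lightbulb_process M n X
    by (rule assms(2))
  define m :: nat where "m = (if n mod 4 \<in> {0, 3} then 0 else 1)"
  let ?V = "{1..n}" and ?f = "\<lambda>x. prob {\<omega> \<in> space M. lit n X \<omega> = x} - uniform_parity_class {1..n} m x"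
  have "\<bar>prob {\<omega> \<in> space M. int (bulbs_on n X \<omega>) \<in> A} - measure N {\<omega> \<in> space N. int (C \<omega>) \<in> A}\<bar>
      \<le> (\<Sum>x\<in>Pow ?V. \<bar>?f x\<bar>)" for A
  proof -
    have "prob {\<omega> \<in> space M. int (card (lit n X \<omega>)) \<in> A}
        = (\<Sum>x\<in>{x \<in> Pow ?V. int (card x) \<in> A}. prob {\<omega> \<in> space M. lit n X \<omega> = x})"
      by (rule prob_finite_support[OF lit_measurable]) (auto simp: lit_def)
    moreover have "measure N {\<omega> \<in> space N. int (C \<omega>) \<in> A}
        = (\<Sum>x\<in>{x \<in> Pow ?V. int (card x) \<in> A}. uniform_parity_class ?V m x)"
      using assms by (intro clubbed_binomial_prob) (auto simp: m_def)
    ultimately have "\<bar>prob {\<omega> \<in> space M. int (bulbs_on n X \<omega>) \<in> A} - measure N {\<omega> \<in> space N. int (C \<omega>) \<in> A}\<bar>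
        = \<bar>\<Sum>x\<in>{x \<in> Pow ?V. int (card x) \<in> A}. ?f x\<bar>"
      by (simp add: card_lit sum_subtractf)
    also have "\<dots> \<le> (\<Sum>x\<in>{x \<in> Pow ?V. int (card x) \<in> A}. \<bar>?f x\<bar>)"
      by (rule sum_abs)
    also have "\<dots> \<le> (\<Sum>x\<in>Pow ?V. \<bar>?f x\<bar>)"
      by (rule sum_mono2) auto
    finally show ?thesis .
  qed
  then have "tv_dist M (\<lambda>\<omega>. int (bulbs_on n X \<omega>)) N (\<lambda>\<omega>. int (C \<omega>)) \<le> (\<Sum>x\<in>Pow ?V. \<bar>?f x\<bar>)"
    unfolding tv_dist_def by (intro cSUP_least) auto
  also have "\<dots> \<le> sqrt (3 * n * exp (- 2 * (n + 1) / 3))"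
    by (rule l1_distance_lit_le) (use assms(1) in \<open>simp_all add: m_def\<close>)
  also have "\<dots> = sqrt 3 * sqrt n * exp (- (real n + 1) / 3)"
  proof -
    have "exp (- 2 * (n + 1) / 3) = (exp (- (real n + 1) / 3))\<^sup>2"
      by (simp add: exp_double [symmetric])
    then show ?thesis
      by (simp add: real_sqrt_mult)
  qed
  also have "\<dots> \<le> 2.7314 * sqrt (real n) * exp (- (real n + 1) / 3)"
    by (intro mult_right_mono real_le_lsqrt) (auto simp: power2_eq_square)
  finally show ?thesis .
qed

end
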